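(* Let $\alpha,\beta,\gamma,\delta,w\in\mathbb{C}$ with $\gamma\notin\{0,-1,-2,\ldots\}$, and let $k\in(0,1)$. For integers $0\le m\le n$ define $f_{m,n}:=k^{2n}$ if $m=0$, and, if $m\geq1$, $$f_{m,n}:=(-1)^{m}k^{2n-2m}\sum_{0\leq\ell_{1}\leq j_{1}<\ell_{2}\leq j_{2}<\cdots<\ell_{m}\leq j_{m}<n}\ \prod_{s=1}^{m}\frac{j_{s}!\,(\gamma)_{j_{s}}(\alpha)_{\ell_{s}}(\beta)_{\ell_{s}}}{\ell_{s}!\,(\gamma)_{\ell_{s}}(\alpha)_{j_{s}+1}(\beta)_{j_{s}+1}}\,k^{-2(j_{s}-\ell_{s})}\big(w-(1-k^{2})\delta\,\ell_{s}\big),$$ where the sum runs over all integers $j_1,\dots,j_m,\ell_1,\dots,\ell_m$ satisfying the indicated inequalities, and for $n\ge0$ put $$c_{n}:=\frac{(\alpha)_{n}(\beta)_{n}}{n!\,(\gamma)_{n}}\sum_{m=0}^{n}f_{m,n}.$$ Then, for all $n\geq0$, $$|c_{n}|\leq\frac{\big((d)_{n}\big)^{2}}{n!\,|(\gamma)_{n}|}\,\exp\bigg(\frac{t}{1-k^{2}}\sum_{j=1}^{n}\frac{1}{j}\bigg),$$ where $$d:=\max\{1,|\alpha|,|\beta|,|\gamma|\},\qquad t:=|w|+(1-k^{2})|\delta|.$$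
   Context: $(x)_n:=x(x+1)\cdots(x+n-1)$ is the Pochhammer symbol, with $(x)_0=1$. Convention for degenerate parameters: if $\alpha$ or $\beta$ is a non-positive integer, the product $(\alpha)_n(\beta)_n f_{m,n}$ occurring in $c_n$ is understood after cancellation of common factors: for $0\leq\ell_{1}\leq j_{1}<\cdots<\ell_{m}\leq j_{m}<n$ the expression $(x)_{n}\prod_{s=1}^{m}\frac{(x)_{\ell_{s}}}{(x)_{j_{s}+1}}$ is a polynomial in $x$, namely the product of $(x+i)$ over those $i\in\{0,\dots,n-1\}$ not lying in any of the intervals $[\ell_s,j_s]$, and it is evaluated as this polynomial at $x=\alpha$ and $x=\beta$. *)

theory Defs
  imports Complex_Main "HOL-Library.FuncSet" "HOL-Library.Nonpos_Ints"
begin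

text \<open>
  Pairs \<open>(l, j)\<close> of sequences with \<open>l 1 \<le> j 1 < l 2 \<le> j 2 < \<dots> < l m \<le> j m < n\<close>;
  the sequences are extensional on \<open>{1..m}\<close>, so that each choice of integers is counted once.
\<close>

definition index_chains :: "nat \<Rightarrow> nat \<Rightarrow> ((nat \<Rightarrow> nat) \<times> (nat \<Rightarrow> nat)) set" where
  "index_chains m n = {(l, j). l \<in> {1..m} \<rightarrow>\<^sub>E {..<n} \<and> j \<in> {1..m} \<rightarrow>\<^sub>E {..<n} \<and>
     (\<forall>s\<in>{1..m}. l s \<le> j s) \<and> (\<forall>s\<in>{1..<m}. j s < l (Suc s))}"

definition f_coeff ::
    "complex \<Rightarrow> complex \<Rightarrow> complex \<Rightarrow> complex \<Rightarrow> complex \<Rightarrow> real \<Rightarrow> nat \<Rightarrow> nat \<Rightarrow> complex" where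
  "f_coeff \<alpha> \<beta> \<gamma> \<delta> w k m n =
    (if m = 0 then of_real k ^ (2 * n)
     else (-1) ^ m * of_real k ^ (2 * n - 2 * m) *
       (\<Sum>(l, j)\<in>index_chains m n. \<Prod>s=1..m.
          (fact (j s) * pochhammer \<gamma> (j s) * pochhammer \<alpha> (l s) * pochhammer \<beta> (l s)) /
          (fact (l s) * pochhammer \<gamma> (l s) * pochhammer \<alpha> (j s + 1) * pochhammer \<beta> (j s + 1)) *
          of_real k powi (- 2 * (int (j s) - int (l s))) *
          (w - (1 - of_real k ^ 2) * \<delta> * of_nat (l s))))"

text \<open>
  The polynomial in \<open>x\<close> obtained from
  \<open>(x)\<^sub>n \<Prod>s=1..m. (x)\<^bsub>l s\<^esub> / (x)\<^bsub>j s + 1\<^esub>\<close> by cancelling common factors.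
\<close>

definition cancelled_pochhammer ::
    "nat \<Rightarrow> nat \<Rightarrow> (nat \<Rightarrow> nat) \<Rightarrow> (nat \<Rightarrow> nat) \<Rightarrow> complex \<Rightarrow> complex" where
  "cancelled_pochhammer m n l j x = (\<Prod>i \<in> {..<n} - (\<Union>s\<in>{1..m}. {l s..j s}). x + of_nat i)"

text \<open>
  The product \<open>(\<alpha>)\<^sub>n (\<beta>)\<^sub>n f\<^bsub>m,n\<^esub>\<close> after cancellation, which makes sense for all
  \<open>\<alpha>\<close> and \<open>\<beta>\<close>.
\<close>

definition cancelled_f_coeff ::
    "complex \<Rightarrow> complex \<Rightarrow> complex \<Rightarrow> complex \<Rightarrow> complex \<Rightarrow> real \<Rightarrow> nat \<Rightarrow> nat \<Rightarrow> complex" where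
  "cancelled_f_coeff \<alpha> \<beta> \<gamma> \<delta> w k m n =
    (if m = 0 then pochhammer \<alpha> n * pochhammer \<beta> n * of_real k ^ (2 * n)
     else (-1) ^ m * of_real k ^ (2 * n - 2 * m) *
       (\<Sum>(l, j)\<in>index_chains m n.
          cancelled_pochhammer m n l j \<alpha> * cancelled_pochhammer m n l j \<beta> *
          (\<Prod>s=1..m.
            (fact (j s) * pochhammer \<gamma> (j s)) / (fact (l s) * pochhammer \<gamma> (l s)) *
            of_real k powi (- 2 * (int (j s) - int (l s))) *
            (w - (1 - of_real k ^ 2) * \<delta> * of_nat (l s)))))"

definition c_coeff ::
    "complex \<Rightarrow> complex \<Rightarrow> complex \<Rightarrow> complex \<Rightarrow> complex \<Rightarrow> real \<Rightarrow> nat \<Rightarrow> complex" where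
  "c_coeff \<alpha> \<beta> \<gamma> \<delta> w k n =
    (if \<alpha> \<in> \<int>\<^sub>\<le>\<^sub>0 \<or> \<beta> \<in> \<int>\<^sub>\<le>\<^sub>0
     then (\<Sum>m=0..n. cancelled_f_coeff \<alpha> \<beta> \<gamma> \<delta> w k m n) / (fact n * pochhammer \<gamma> n)
     else pochhammer \<alpha> n * pochhammer \<beta> n / (fact n * pochhammer \<gamma> n) *
       (\<Sum>m=0..n. f_coeff \<alpha> \<beta> \<gamma> \<delta> w k m n))"

text \<open>The cancelled form agrees with the quotient form wherever the latter is defined.\<close>

lemma index_chains_less:
  assumes "(l, j) \<in> index_chains m n" "1 \<le> s" "s < s'" "s' \<le> m"
  shows "j s < l s'"
  using assms(3,4)
proof (induction s' rule: less_induct)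
  case (less s')
  then obtain r where r: "s' = Suc r" "s \<le> r" by (cases s') auto
  from assms(1) have ch: "\<forall>s\<in>{1..m}. l s \<le> j s" "\<forall>s\<in>{1..<m}. j s < l (Suc s)"
    by (auto simp: index_chains_def)
  have step: "j r < l s'" using ch(2) r less.prems assms(2) by auto
  show ?case
  proof (cases "s = r")
    case False
    then have "j s < l r" using less.IH[of r] r less.prems by auto
    moreover have "l r \<le> j r" using ch(1) r less.prems assms(2) by auto
    ultimately show ?thesis using step by linarith
  qed (use step in simp)
qed

lemma cancelled_pochhammer_eq:
  assumes c: "(l, j) \<in> index_chains m n" and x: "x \<notin> \<int>\<^sub>\<le>\<^sub>0"
  shows "cancelled_pochhammer m n l j x =
    pochhammer x n * (\<Prod>s=1..m. pochhammer x (l s) / pochhammer x (j s + 1))"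
proof -
  have nz: "x + of_nat i \<noteq> 0" for i
    using x by (metis add_eq_0_iff2 minus_of_nat_in_nonpos_Ints)
  have pz: "pochhammer x i \<noteq> 0" for i
    by (simp add: pochhammer_prod nz)
  let ?I = "\<lambda>s. {l s..j s}" and ?g = "\<lambda>i. x + of_nat i"
  have le: "l s \<le> j s" "j s < n" if "s \<in> {1..m}" for s
    using c that by (auto simp: index_chains_def PiE_iff)
  have disj: "?I s \<inter> ?I s' = {}" if "s \<in> {1..m}" "s' \<in> {1..m}" "s \<noteq> s'" for s s'
    using index_chains_less[OF c, of s s'] index_chains_less[OF c, of s' s] that
    by (cases s s' rule: linorder_cases) auto
  have I: "prod ?g (?I s) = pochhammer x (j s + 1) / pochhammer x (l s)" if "s \<in> {1..m}" for s
  proof -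
    have "{0..<j s + 1} = {0..<l s} \<union> ?I s" using le[OF that] by auto
    then have "pochhammer x (j s + 1) = pochhammer x (l s) * prod ?g (?I s)"
      unfolding pochhammer_prod by (subst prod.union_disjoint [symmetric]) auto
    then show ?thesis using pz by simp
  qed
  have U: "prod ?g (\<Union>s\<in>{1..m}. ?I s) = (\<Prod>s=1..m. prod ?g (?I s))"
    by (rule prod.UNION_disjoint) (use disj in auto)
  have sub: "(\<Union>s\<in>{1..m}. ?I s) \<subseteq> {..<n}" using le by fastforce
  have "pochhammer x n = cancelled_pochhammer m n l j x * prod ?g (\<Union>s\<in>{1..m}. ?I s)"
    unfolding cancelled_pochhammer_def pochhammer_prod atLeast0LessThan
    by (rule prod.subset_diff[OF sub]) simp
  also have "prod ?g (\<Union>s\<in>{1..m}. ?I s) =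
      (\<Prod>s=1..m. pochhammer x (j s + 1) / pochhammer x (l s))"
    unfolding U by (rule prod.cong) (use I in auto)
  finally show ?thesis
    using pz by (simp add: prod_dividef)
qed

lemma cancelled_f_coeff_eq:
  assumes "\<alpha> \<notin> \<int>\<^sub>\<le>\<^sub>0" "\<beta> \<notin> \<int>\<^sub>\<le>\<^sub>0"
  shows "cancelled_f_coeff \<alpha> \<beta> \<gamma> \<delta> w k m n =
    pochhammer \<alpha> n * pochhammer \<beta> n * f_coeff \<alpha> \<beta> \<gamma> \<delta> w k m n"
proof (cases "m = 0")
  case False
  show ?thesis
    unfolding cancelled_f_coeff_def f_coeff_def using False
    apply (simp only: if_False sum_distrib_left)
    apply (rule sum.cong[OF refl])
    apply (clarsimp simp only: case_prod_conv cancelled_pochhammer_eq[OF _ assms(1)]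
        cancelled_pochhammer_eq[OF _ assms(2)])
    apply (simp add: prod_dividef prod.distrib mult_ac)
    done
qed (simp add: cancelled_f_coeff_def f_coeff_def)

lemma c_coeff_eq_cancelled:
  "c_coeff \<alpha> \<beta> \<gamma> \<delta> w k n =
    (\<Sum>m=0..n. cancelled_f_coeff \<alpha> \<beta> \<gamma> \<delta> w k m n) / (fact n * pochhammer \<gamma> n)"
  by (simp add: c_coeff_def cancelled_f_coeff_eq sum_distrib_left sum_divide_distrib)

end

theory Submission
  imports Defs
begin

text \<open>
  Put \<open>q = k\<^sup>2\<close> and divide every summand of \<open>c\<^sub>n\<close> by \<open>(d)\<^sub>n\<^sup>2\<close>. An index \<open>i < n\<close> outside all
  intervals \<open>[l s, j s]\<close> then contributes at most \<open>q\<close>, and the \<open>s\<close>-th interval contributes at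
  most \<open>t / (j s + 1)\<close>. Let \<open>A n\<close> be the sum of these majorants over all chains. Looking
  at the interval that covers the last index, if there is one, gives
  \<open>A (n + 1) \<le> q * A n + t / (n + 1) * (A 0 + \<dots> + A n)\<close>. Hence
  \<open>V n = A n + (1 - q) * (A 0 + \<dots> + A (n - 1))\<close> grows at most by the factor
  \<open>1 + t / ((1 - q) * (n + 1))\<close> in each step, and \<open>A n \<le> V n\<close>.
\<close>

section \<open>Majorants of single chains and their sums\<close>

definition uncovered :: "nat \<Rightarrow> nat \<Rightarrow> (nat \<Rightarrow> nat) \<Rightarrow> (nat \<Rightarrow> nat) \<Rightarrow> nat set" where
  "uncovered m n l j = {..<n} - (\<Union>s\<in>{1..m}. {l s..j s})"

text \<open>The powers of \<open>k\<close> in a summand combine to one factor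
  \<open>k\<^sup>2\<close> per uncovered index. With \<open>q\<close> standing for
  \<open>k\<^sup>2\<close>, the starts \<open>l s\<close> therefore enter only through
  \<open>uncovered\<close>.\<close>

definition chain_weight ::
    "real \<Rightarrow> real \<Rightarrow> nat \<Rightarrow> nat \<Rightarrow> (nat \<Rightarrow> nat) \<times> (nat \<Rightarrow> nat) \<Rightarrow> real" where
  "chain_weight q t m n =
    (\<lambda>(l, j). q ^ card (uncovered m n l j) * (\<Prod>s=1..m. t / real (Suc (j s))))"

definition chain_sum :: "real \<Rightarrow> real \<Rightarrow> nat \<Rightarrow> nat \<Rightarrow> real" where
  "chain_sum q t m n = sum (chain_weight q t m n) (index_chains m n)"

lemma finite_uncovered [simp]: "finite (uncovered m n l j)"
  by (simp add: uncovered_def)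

lemma chain_weight_nonneg: "0 \<le> q \<Longrightarrow> 0 \<le> t \<Longrightarrow> 0 \<le> chain_weight q t m n p"
  by (auto simp: chain_weight_def split: prod.split intro!: mult_nonneg_nonneg prod_nonneg)

lemma chain_sum_nonneg: "0 \<le> q \<Longrightarrow> 0 \<le> t \<Longrightarrow> 0 \<le> chain_sum q t m n"
  by (simp add: chain_sum_def chain_weight_nonneg sum_nonneg)

lemma finite_index_chains [simp]: "finite (index_chains m n)"
proof (rule finite_subset)
  show "index_chains m n \<subseteq> ({1..m} \<rightarrow>\<^sub>E {..<n}) \<times> ({1..m} \<rightarrow>\<^sub>E {..<n})"
    by (auto simp: index_chains_def)
qed (auto intro!: finite_PiE)

text \<open>\<open>\<lambda>_. undefined\<close> is the only extensional function on the empty index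
  set, so the empty chain is counted exactly once.\<close>

lemma index_chains_0: "index_chains 0 n = {(\<lambda>_. undefined, \<lambda>_. undefined)}"
  by (auto simp: index_chains_def)

lemma chain_sum_0: "chain_sum q t 0 n = q ^ n"
  by (simp add: chain_sum_def index_chains_0 chain_weight_def uncovered_def)

lemma chain_sum_Suc_0: "chain_sum q t (Suc m) 0 = 0"
proof -
  have "index_chains (Suc m) 0 = {}"
    by (auto simp: index_chains_def PiE_iff)
  then show ?thesis by (simp add: chain_sum_def)
qed

lemma index_chainsD:
  assumes "(l, j) \<in> index_chains m n" "s \<in> {1..m}"
  shows "l s \<le> j s" "j s < n"
  using assms by (auto simp: index_chains_def PiE_iff)

lemma index_chains_disjoint:
  assumes c: "(l, j) \<in> index_chains m n" and "s \<in> {1..m}" "s' \<in> {1..m}" "s \<noteq> s'"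
  shows "{l s..j s} \<inter> {l s'..j s'} = {}"
  using index_chains_less[OF c, of s s'] index_chains_less[OF c, of s' s] assms
  by (cases s s' rule: linorder_cases) auto

section \<open>Recursion on the last interval\<close>

text \<open>If the last interval ends before \<open>n\<close>, the whole chain lies below
  \<open>n\<close>. Otherwise it is \<open>[L, n]\<close>, and deleting it leaves a chain of
  \<open>m\<close> intervals below \<open>L\<close>. An inclusion suffices for upper bounds on sums
  of nonnegative weights.\<close>

lemma index_chains_Suc_subset:
  "index_chains (Suc m) (Suc n) \<subseteq> index_chains (Suc m) n \<union>
     (\<lambda>(L, l, j). (l(Suc m := L), j(Suc m := n))) ` (SIGMA L:{..n}. index_chains m L)"
proof
  fix p assume "p \<in> index_chains (Suc m) (Suc n)"
  then obtain l j where p: "p = (l, j)" and c: "(l, j) \<in> index_chains (Suc m) (Suc n)"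
    by (cases p) auto
  have last: "l (Suc m) \<le> j (Suc m)" "j (Suc m) < Suc n"
    using index_chainsD[OF c, of "Suc m"] by auto
  have less: "j s < l (Suc m)" if "s \<in> {1..m}" for s
    using index_chains_less[OF c, of s "Suc m"] that by auto
  have le: "l s \<le> j s" if "s \<in> {1..Suc m}" for s
    using index_chainsD(1)[OF c that] .
  show "p \<in> index_chains (Suc m) n \<union>
     (\<lambda>(L, l, j). (l(Suc m := L), j(Suc m := n))) ` (SIGMA L:{..n}. index_chains m L)"
  proof (cases "j (Suc m) < n")
    case True
    have "j s < n" if "s \<in> {1..Suc m}" for s
      using less[of s] last True that by (cases "s = Suc m") auto
    moreover have "l s < n" if "s \<in> {1..Suc m}" for s
      using calculation[OF that] le[OF that] by linarith
    ultimately have "(l, j) \<in> index_chains (Suc m) n"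
      using c by (auto simp: index_chains_def PiE_iff)
    then show ?thesis by (simp add: p)
  next
    case False
    then have jn: "j (Suc m) = n" using last by simp
    \<comment> \<open>Restriction resets the value at \<open>Suc m\<close> to
      \<open>undefined\<close>, as the extensionality in \<open>index_chains m\<close>
      demands.\<close>
    let ?l = "restrict l {1..m}" and ?j = "restrict j {1..m}"
    have "l s < l (Suc m)" if "s \<in> {1..m}" for s
      using less[OF that] le[of s] that by auto
    then have "(?l, ?j) \<in> index_chains m (l (Suc m))"
      using c less by (auto simp: index_chains_def PiE_iff)
    moreover have "l = ?l(Suc m := l (Suc m))" "j = ?j(Suc m := n)"
      using c jn by (auto simp: index_chains_def PiE_iff extensional_def fun_eq_iff)
    ultimately show ?thesis
      unfolding p using last
      by (intro UnI2 rev_image_eqI[where x = "(l (Suc m), ?l, ?j)"]) auto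
  qed
qed

lemma chain_weight_Suc:
  assumes "(l, j) \<in> index_chains m n"
  shows "chain_weight q t m (Suc n) (l, j) = q * chain_weight q t m n (l, j)"
proof -
  have "uncovered m (Suc n) l j = insert n (uncovered m n l j)"
    using index_chainsD(2)[OF assms] by (fastforce simp: uncovered_def)
  moreover have "n \<notin> uncovered m n l j" by (simp add: uncovered_def)
  ultimately show ?thesis by (simp add: chain_weight_def)
qed

text \<open>The new interval covers everything from \<open>L\<close> to \<open>n\<close>, so the
  uncovered indices are those that the shorter chain leaves below \<open>L\<close>.\<close>

lemma chain_weight_extend:
  assumes "L \<le> n"
  shows "chain_weight q t (Suc m) (Suc n) (l(Suc m := L), j(Suc m := n)) =
    t / real (Suc n) * chain_weight q t m L (l, j)"
proof -
  have U: "(\<Union>s\<in>{1..Suc m}. {(l(Suc m := L)) s..(j(Suc m := n)) s}) =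
      (\<Union>s\<in>{1..m}. {l s..j s}) \<union> {L..n}"
    by (auto simp: atLeastAtMostSuc_conv)
  have "uncovered (Suc m) (Suc n) (l(Suc m := L)) (j(Suc m := n)) = uncovered m L l j"
    unfolding uncovered_def U using assms by auto
  then show ?thesis by (simp add: chain_weight_def)
qed

lemma chain_sum_Suc_Suc:
  assumes q: "0 \<le> q" and t: "0 \<le> t"
  shows "chain_sum q t (Suc m) (Suc n) \<le>
    q * chain_sum q t (Suc m) n + t / real (Suc n) * (\<Sum>L\<le>n. chain_sum q t m L)"
proof -
  let ?W = "chain_weight q t (Suc m) (Suc n)"
  let ?e = "\<lambda>(L, l, j). (l(Suc m := L), j(Suc m := n))"
  let ?X = "SIGMA L:{..n}. index_chains m L"
  note W0 = chain_weight_nonneg[OF q t]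
  have "chain_sum q t (Suc m) (Suc n) \<le> sum ?W (index_chains (Suc m) n \<union> ?e ` ?X)"
    unfolding chain_sum_def
    by (rule sum_mono2[OF _ index_chains_Suc_subset]) (auto intro: W0)
  also have "\<dots> \<le> sum ?W (index_chains (Suc m) n) + sum ?W (?e ` ?X)"
    by (subst sum_Un) (auto intro!: sum_nonneg W0)
  also have "sum ?W (index_chains (Suc m) n) = q * chain_sum q t (Suc m) n"
    unfolding chain_sum_def sum_distrib_left
    by (rule sum.cong) (auto simp: chain_weight_Suc)
  \<comment> \<open>Passing from the image to its index set can only repeat nonnegative terms, so
    injectivity of the gluing map is not at issue.\<close>
  also have "sum ?W (?e ` ?X) \<le> sum (?W \<circ> ?e) ?X"
    by (rule sum_image_le) (auto intro: W0)
  also have "\<dots> = (\<Sum>(L, p)\<in>?X. t / real (Suc n) * chain_weight q t m L p)"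
    by (rule sum.cong) (auto simp: chain_weight_extend simp del: of_nat_Suc)
  also have "\<dots> = t / real (Suc n) * (\<Sum>L\<le>n. chain_sum q t m L)"
    unfolding chain_sum_def sum_distrib_left by (rule sum.Sigma [symmetric]) auto
  finally show ?thesis by simp
qed

section \<open>A discrete Gronwall estimate\<close>

text \<open>The potential is chosen so that its sum part gains \<open>(1 - q) * A n\<close> in a
  step, which completes the term \<open>q * A n\<close> of the recursion to \<open>A n\<close>. What
  remains is the increment \<open>t / real (Suc n) * ?U\<close>, and \<open>?U\<close> is controlled
  by the potential itself.\<close>

lemma renewal_bound:
  fixes A :: "nat \<Rightarrow> real"
  assumes q: "0 \<le> q" "q < 1" and t: "0 \<le> t" and A: "\<And>n. 0 \<le> A n" and A0: "A 0 \<le> 1"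
    and rec: "\<And>n. A (Suc n) \<le> q * A n + t / real (Suc n) * (\<Sum>i\<le>n. A i)"
  shows "A n \<le> exp (t / (1 - q) * (\<Sum>j=1..n. 1 / real j))"
proof -
  have V: "A n + (1 - q) * (\<Sum>i<n. A i) \<le> exp (t / (1 - q) * (\<Sum>j=1..n. 1 / real j))" for n
  proof (induction n)
    case 0
    show ?case using A0 by simp
  next
    case (Suc n)
    let ?V = "A n + (1 - q) * (\<Sum>i<n. A i)" and ?U = "\<Sum>i\<le>n. A i"
    have U: "?U = (\<Sum>i<n. A i) + A n"
      by (simp add: lessThan_Suc_atMost [symmetric])
    \<comment> \<open>\<open>(1 - q) * ?U\<close> equals \<open>?V - q * A n\<close>.\<close>
    have "0 \<le> q * A n" using q A by simp
    then have "(1 - q) * ?U \<le> ?V" unfolding U by (simp add: algebra_simps)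
    then have U_le: "?U \<le> ?V / (1 - q)" using q by (simp add: field_simps)
    have "A (Suc n) + (1 - q) * (\<Sum>i<Suc n. A i) \<le>
        q * A n + t / real (Suc n) * ?U + (1 - q) * (\<Sum>i<Suc n. A i)"
      using rec[of n] by simp
    also have "\<dots> = ?V + t / real (Suc n) * ?U"
      by (simp add: algebra_simps)
    also have "\<dots> \<le> ?V + t / real (Suc n) * (?V / (1 - q))"
      using t U_le by (intro add_left_mono mult_left_mono) auto
    also have "\<dots> = (1 + t / (1 - q) * (1 / real (Suc n))) * ?V"
      by (simp only: distrib_right mult_1 times_divide_eq_left times_divide_eq_right
          divide_divide_eq_left mult_1_right mult.commute)
    \<comment> \<open>By \<open>1 + x \<le> exp x\<close> the growth factors multiply to the
      exponential of a harmonic sum.\<close>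
    also have "\<dots> \<le> exp (t / (1 - q) * (1 / real (Suc n))) *
        exp (t / (1 - q) * (\<Sum>j=1..n. 1 / real j))"
      using Suc.IH q t A by (intro mult_mono exp_ge_add_one_self add_nonneg_nonneg
          mult_nonneg_nonneg sum_nonneg) auto
    also have "\<dots> = exp (t / (1 - q) * (\<Sum>j=1..Suc n. 1 / real j))"
      by (simp add: exp_add [symmetric] ring_distribs)
    finally show ?case .
  qed
  have "0 \<le> (1 - q) * (\<Sum>i<n. A i)" using q A by (simp add: sum_nonneg)
  with V[of n] show ?thesis by linarith
qed

text \<open>A cutoff \<open>N\<close> independent of \<open>n\<close> makes the sum over
  \<open>m\<close> a single sequence in \<open>n\<close>, to which \<open>renewal_bound\<close>
  applies.\<close>

lemma sum_chain_sum_le: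
  assumes q: "0 \<le> q" "q < 1" and t: "0 \<le> t"
  shows "(\<Sum>m\<le>N. chain_sum q t m n) \<le> exp (t / (1 - q) * (\<Sum>j=1..n. 1 / real j))"
proof (rule renewal_bound[OF q t])
  show "0 \<le> (\<Sum>m\<le>N. chain_sum q t m n)" for n
    using q t by (simp add: chain_sum_nonneg sum_nonneg)
  show "(\<Sum>m\<le>N. chain_sum q t m 0) \<le> 1"
    by (simp add: sum.atMost_shift chain_sum_0 chain_sum_Suc_0)
  show "(\<Sum>m\<le>N. chain_sum q t m (Suc n)) \<le> q * (\<Sum>m\<le>N. chain_sum q t m n) +
      t / real (Suc n) * (\<Sum>i\<le>n. \<Sum>m\<le>N. chain_sum q t m i)" for n
  proof -
    let ?S = "chain_sum q t"
    \<comment> \<open>The recursion raises \<open>m\<close> by one, so only \<open>m < N\<close>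
      occurs on its right-hand side; adding the nonnegative term \<open>m = N\<close> restores the
      full sum.\<close>
    have "(\<Sum>m<N. \<Sum>i\<le>n. ?S m i) \<le> (\<Sum>m\<le>N. \<Sum>i\<le>n. ?S m i)"
      using q t by (intro sum_mono2 sum_nonneg chain_sum_nonneg) auto
    then have le: "t / real (Suc n) * (\<Sum>m<N. \<Sum>i\<le>n. ?S m i) \<le>
        t / real (Suc n) * (\<Sum>i\<le>n. \<Sum>m\<le>N. ?S m i)"
      using t by (subst (2) sum.swap) (intro mult_left_mono, auto)
    have "(\<Sum>m<N. ?S (Suc m) (Suc n)) \<le>
        (\<Sum>m<N. q * ?S (Suc m) n + t / real (Suc n) * (\<Sum>i\<le>n. ?S m i))"
      by (intro sum_mono chain_sum_Suc_Suc q t)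
    also have "\<dots> = q * (\<Sum>m<N. ?S (Suc m) n) +
        t / real (Suc n) * (\<Sum>m<N. \<Sum>i\<le>n. ?S m i)"
      by (simp add: sum.distrib sum_distrib_left)
    \<comment> \<open>The split-off term \<open>m = 0\<close> satisfies the recursion exactly, as
      \<open>q ^ Suc n = q * q ^ n\<close>.\<close>
    finally show ?thesis
      using le by (simp add: sum.atMost_shift[of _ N] chain_sum_0 ring_distribs)
  qed
qed

section \<open>Comparing the summands with the majorants\<close>

text \<open>Applied to the constant \<open>k\<^sup>2\<close> this counts exponents; applied to
  \<open>(d + real i)\<^sup>2\<close> it distributes \<open>(pochhammer d n)\<^sup>2\<close> over
  gaps and intervals.\<close>

lemma prod_uncovered:
  fixes g :: "nat \<Rightarrow> 'a::comm_monoid_mult"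
  assumes c: "(l, j) \<in> index_chains m n"
  shows "prod g {..<n} = prod g (uncovered m n l j) * (\<Prod>s=1..m. prod g {l s..j s})"
proof -
  have U: "prod g (\<Union>s\<in>{1..m}. {l s..j s}) = (\<Prod>s=1..m. prod g {l s..j s})"
    by (rule prod.UNION_disjoint) (use index_chains_disjoint[OF c] in auto)
  have sub: "(\<Union>s\<in>{1..m}. {l s..j s}) \<subseteq> {..<n}"
    using index_chainsD[OF c] by fastforce
  show ?thesis
    unfolding U [symmetric] uncovered_def by (rule prod.subset_diff[OF sub]) simp
qed

text \<open>Interval \<open>s\<close> has \<open>j s - l s + 1\<close> indices: its
  \<open>powi\<close> factor removes \<open>k\<^sup>2\<close> for all but one of them, and the
  exponent \<open>2 * n - 2 * m\<close> removes the last one. The bound \<open>m \<le> n\<close>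
  keeps the natural subtraction from truncating.\<close>

lemma power_card_uncovered:
  fixes k :: real
  assumes c: "(l, j) \<in> index_chains m n" and k: "k \<noteq> 0" and m: "m \<le> n"
  shows "k ^ (2 * n - 2 * m) * (\<Prod>s=1..m. k powi (- 2 * (int (j s) - int (l s)))) =
    (k\<^sup>2) ^ card (uncovered m n l j)"
proof -
  let ?P = "\<Prod>s=1..m. k powi (- 2 * (int (j s) - int (l s)))"
  have s: "k\<^sup>2 * inverse (k powi (- 2 * (int (j s) - int (l s)))) = (\<Prod>i\<in>{l s..j s}. k\<^sup>2)"
    if "s \<in> {1..m}" for s
  proof -
    have le: "l s \<le> j s" using index_chainsD(1)[OF c that] .
    then have "2 * (int (j s) - int (l s)) = int (2 * (j s - l s))" by auto
    then have "inverse (k powi (- 2 * (int (j s) - int (l s)))) = k ^ (2 * (j s - l s))"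
      by (metis inverse_inverse_eq mult_minus_left power_int_minus power_int_of_nat)
    then show ?thesis
      using le by (simp add: power_mult Suc_diff_le)
  qed
  have "(\<Prod>s=1..m. \<Prod>i\<in>{l s..j s}. k\<^sup>2) =
      (\<Prod>s=1..m. k\<^sup>2 * inverse (k powi (- 2 * (int (j s) - int (l s)))))"
    by (rule prod.cong[OF refl]) (use s in simp)
  also have "\<dots> = k ^ (2 * m) * inverse ?P"
    using prod_inversef[of "\<lambda>s. k powi (- 2 * (int (j s) - int (l s)))" "{1..m}"]
    by (simp only: prod.distrib comp_def) (simp add: power_mult)
  finally have "k ^ (2 * n) = (k\<^sup>2) ^ card (uncovered m n l j) * (k ^ (2 * m) * inverse ?P)"
    using prod_uncovered[OF c, of "\<lambda>_. k\<^sup>2"] by (simp add: power_mult)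
  moreover have "k ^ (2 * n) = k ^ (2 * n - 2 * m) * k ^ (2 * m)"
    using m by (simp add: power_add [symmetric])
  moreover have "?P \<noteq> 0" using k by simp
  ultimately show ?thesis using k by (simp add: field_simps)
qed

text \<open>The quotient is the product of \<open>(i + 1) * (\<gamma> + i)\<close> over
  \<open>l \<le> i < j\<close>, and both factors have modulus at most \<open>d + i\<close>. The
  first of these bounds is where \<open>1 \<le> d\<close> enters.\<close>

lemma norm_fact_pochhammer_quotient_le:
  fixes \<gamma> :: complex
  assumes "\<gamma> \<notin> \<int>\<^sub>\<le>\<^sub>0" "cmod \<gamma> \<le> d" "1 \<le> d" "l \<le> j"
  shows "cmod ((fact j * pochhammer \<gamma> j) / (fact l * pochhammer \<gamma> l)) \<le>
    (\<Prod>i\<in>{l..<j}. (d + real i)\<^sup>2)"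
  using assms(4)
proof (induction j rule: dec_induct)
  case base
  have "pochhammer \<gamma> l \<noteq> 0"
    using assms(1) by (auto simp: pochhammer_eq_0_iff minus_of_nat_in_nonpos_Ints)
  then show ?case by simp
next
  case (step j)
  let ?R = "\<lambda>j. (fact j * pochhammer \<gamma> j) / (fact l * pochhammer \<gamma> l)"
  have "?R (Suc j) = ?R j * (of_nat (Suc j) * (\<gamma> + of_nat j))"
    by (simp add: pochhammer_Suc)
  then have "cmod (?R (Suc j)) = cmod (?R j) * (real (Suc j) * cmod (\<gamma> + of_nat j))"
    by (simp only: norm_mult norm_of_nat)
  also have "\<dots> \<le> (\<Prod>i\<in>{l..<j}. (d + real i)\<^sup>2) * ((d + real j) * (d + real j))"
  proof (intro mult_mono step.IH)
    show "cmod (\<gamma> + of_nat j) \<le> d + real j"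
      using norm_triangle_ineq[of \<gamma> "of_nat j"] assms(2) by simp
  qed (use assms(3) in \<open>auto intro!: prod_nonneg\<close>)
  finally show ?case using step.hyps by (simp add: power2_eq_square)
qed

text \<open>The factorial quotient uses up \<open>(d + real i)\<^sup>2\<close> only for
  \<open>i < j\<close>. The square at \<open>i = j\<close> is left to absorb the linear growth in
  \<open>l\<close>, and a denominator \<open>Suc j\<close> still remains.\<close>

lemma norm_interval_factor_le:
  fixes \<gamma> \<delta> w :: complex and k d :: real
  assumes \<gamma>: "\<gamma> \<notin> \<int>\<^sub>\<le>\<^sub>0" "cmod \<gamma> \<le> d" and d: "1 \<le> d" and k: "0 < k" "k < 1" and lj: "l \<le> j"
  shows "cmod ((fact j * pochhammer \<gamma> j) / (fact l * pochhammer \<gamma> l)) *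
      cmod (w - (1 - of_real k ^ 2) * \<delta> * of_nat l) \<le>
    (cmod w + (1 - k\<^sup>2) * cmod \<delta>) / real (Suc j) * (\<Prod>i\<in>{l..j}. (d + real i)\<^sup>2)"
proof -
  let ?t = "cmod w + (1 - k\<^sup>2) * cmod \<delta>"
  have k2: "0 \<le> 1 - k\<^sup>2" using k by (simp add: power_le_one)
  have t: "0 \<le> ?t" using k2 by simp
  have "cmod (1 - of_real k ^ 2) = 1 - k\<^sup>2"
    using k2 by (metis abs_of_nonneg norm_of_real of_real_1 of_real_diff of_real_power)
  then have "cmod (w - (1 - of_real k ^ 2) * \<delta> * of_nat l) \<le> cmod w + (1 - k\<^sup>2) * cmod \<delta> * real l"
    using norm_triangle_ineq4[of w "(1 - of_real k ^ 2) * \<delta> * of_nat l"] by (simp add: norm_mult)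
  also have "\<dots> \<le> cmod w * real (Suc j) + (1 - k\<^sup>2) * cmod \<delta> * real (Suc j)"
    using lj k2 mult_left_mono[of 1 "real (Suc j)" "cmod w"] by (intro add_mono mult_left_mono) auto
  \<comment> \<open>The bound \<open>?t * real (Suc j)\<close> is rewritten with a square so that
    \<open>Suc j \<le> d + j\<close> applies.\<close>
  also have "\<dots> = ?t / real (Suc j) * (real (Suc j))\<^sup>2"
    by (simp add: field_simps power2_eq_square)
  also have "\<dots> \<le> ?t / real (Suc j) * (d + real j)\<^sup>2"
    using d t by (intro mult_left_mono power_mono) auto
  finally have "cmod ((fact j * pochhammer \<gamma> j) / (fact l * pochhammer \<gamma> l)) *
      cmod (w - (1 - of_real k ^ 2) * \<delta> * of_nat l) \<le>
    (\<Prod>i\<in>{l..<j}. (d + real i)\<^sup>2) * (?t / real (Suc j) * (d + real j)\<^sup>2)"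
    by (intro mult_mono norm_fact_pochhammer_quotient_le \<gamma> d lj) (auto intro!: prod_nonneg)
  also have "\<dots> = ?t / real (Suc j) * (\<Prod>i\<in>{l..j}. (d + real i)\<^sup>2)"
    using lj by (simp add: atLeastLessThanSuc_atLeastAtMost [symmetric] mult_ac)
  finally show ?thesis .
qed

lemma norm_cancelled_pochhammer_le:
  assumes "cmod x \<le> d"
  shows "cmod (cancelled_pochhammer m n l j x) \<le> (\<Prod>i\<in>uncovered m n l j. d + real i)"
  unfolding cancelled_pochhammer_def uncovered_def prod_norm [symmetric]
proof (rule prod_mono)
  fix i
  show "0 \<le> cmod (x + of_nat i) \<and> cmod (x + of_nat i) \<le> d + real i"
    using norm_triangle_ineq[of x "of_nat i"] assms by simp
qed

text \<open>At an uncovered index the factors from \<open>\<alpha>\<close> and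
  \<open>\<beta>\<close> give \<open>(d + real i)\<^sup>2\<close>; inside an interval the same
  square comes from the interval factor. Hence \<open>(pochhammer d n)\<^sup>2\<close> splits off
  from every summand.\<close>

lemma norm_cancelled_f_coeff_le:
  fixes \<alpha> \<beta> \<gamma> \<delta> w :: complex and k d :: real
  assumes \<gamma>: "\<gamma> \<notin> \<int>\<^sub>\<le>\<^sub>0" and k: "0 < k" "k < 1" and m: "m \<le> n"
    and d: "1 \<le> d" "cmod \<alpha> \<le> d" "cmod \<beta> \<le> d" "cmod \<gamma> \<le> d"
  shows "cmod (cancelled_f_coeff \<alpha> \<beta> \<gamma> \<delta> w k m n) \<le>
    (pochhammer d n)\<^sup>2 * chain_sum (k\<^sup>2) (cmod w + (1 - k\<^sup>2) * cmod \<delta>) m n"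
proof -
  let ?t = "cmod w + (1 - k\<^sup>2) * cmod \<delta>"
  let ?F = "\<lambda>l j. cancelled_pochhammer m n l j \<alpha> * cancelled_pochhammer m n l j \<beta> *
      (\<Prod>s=1..m. (fact (j s) * pochhammer \<gamma> (j s)) / (fact (l s) * pochhammer \<gamma> (l s)) *
        of_real k powi (- 2 * (int (j s) - int (l s))) *
        (w - (1 - of_real k ^ 2) * \<delta> * of_nat (l s)))"
  \<comment> \<open>The separate branch \<open>m = 0\<close> of the definition is the general
    formula at the empty chain.\<close>
  have eq: "cancelled_f_coeff \<alpha> \<beta> \<gamma> \<delta> w k m n =
      (-1) ^ m * of_real k ^ (2 * n - 2 * m) * (\<Sum>(l, j)\<in>index_chains m n. ?F l j)"
  proof (cases "m = 0")
    case True
    then show ?thesis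
      by (simp add: cancelled_f_coeff_def index_chains_0 cancelled_pochhammer_def
          pochhammer_prod atLeast0LessThan)
  qed (simp add: cancelled_f_coeff_def)
  have summand: "k ^ (2 * n - 2 * m) * cmod (?F l j) \<le>
      (pochhammer d n)\<^sup>2 * chain_weight (k\<^sup>2) ?t m n (l, j)"
    if c: "(l, j) \<in> index_chains m n" for l j
  proof -
    let ?b = "\<lambda>s. cmod ((fact (j s) * pochhammer \<gamma> (j s)) / (fact (l s) * pochhammer \<gamma> (l s))) *
        cmod (w - (1 - of_real k ^ 2) * \<delta> * of_nat (l s))"
    let ?k = "\<lambda>s. k powi (- 2 * (int (j s) - int (l s)))"
    let ?u = "\<Prod>i\<in>uncovered m n l j. d + real i"
    let ?D = "\<lambda>s. \<Prod>i\<in>{l s..j s}. (d + real i)\<^sup>2"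
    let ?T = "\<lambda>s. ?t / real (Suc (j s))"
    have u0: "0 \<le> ?u" using d by (auto intro!: prod_nonneg)
    have b: "(\<Prod>s=1..m. ?b s) \<le> (\<Prod>s=1..m. ?T s * ?D s)"
    proof (rule prod_mono)
      fix s assume "s \<in> {1..m}"
      from norm_interval_factor_le[OF \<gamma> d(4,1) k index_chainsD(1)[OF c this]]
      show "0 \<le> ?b s \<and> ?b s \<le> ?T s * ?D s" by simp
    qed
    have "(\<Prod>i\<in>{..<n}. (d + real i)\<^sup>2) = ?u\<^sup>2 * (\<Prod>s=1..m. ?D s)"
      by (subst prod_uncovered[OF c]) (simp add: prod_power_distrib)
    then have P: "(pochhammer d n)\<^sup>2 = ?u\<^sup>2 * (\<Prod>s=1..m. ?D s)"
      by (simp add: pochhammer_prod atLeast0LessThan prod_power_distrib)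
    have "cmod (?F l j) = cmod (cancelled_pochhammer m n l j \<alpha>) *
        cmod (cancelled_pochhammer m n l j \<beta>) * (\<Prod>s=1..m. ?b s * ?k s)"
      using k by (simp only: norm_mult norm_power_int norm_of_real abs_of_pos
          prod_norm [symmetric] mult_ac)
    also have "\<dots> = (cmod (cancelled_pochhammer m n l j \<alpha>) *
        cmod (cancelled_pochhammer m n l j \<beta>)) * (\<Prod>s=1..m. ?b s) * (\<Prod>s=1..m. ?k s)"
      by (simp only: prod.distrib mult.assoc)
    also have "\<dots> \<le> (?u * ?u) * (\<Prod>s=1..m. ?T s * ?D s) * (\<Prod>s=1..m. ?k s)"
      using k u0 by (intro mult_right_mono mult_mono b norm_cancelled_pochhammer_le d)
        (auto intro!: prod_nonneg mult_nonneg_nonneg)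
    also have "\<dots> = (pochhammer d n)\<^sup>2 * (\<Prod>s=1..m. ?T s) * (\<Prod>s=1..m. ?k s)"
      unfolding P prod.distrib by (simp only: power2_eq_square mult_ac)
    finally have "k ^ (2 * n - 2 * m) * cmod (?F l j) \<le> k ^ (2 * n - 2 * m) *
        ((pochhammer d n)\<^sup>2 * (\<Prod>s=1..m. ?T s) * (\<Prod>s=1..m. ?k s))"
      using k by (intro mult_left_mono) auto
    also have "\<dots> = (pochhammer d n)\<^sup>2 * (k ^ (2 * n - 2 * m) * (\<Prod>s=1..m. ?k s)) * (\<Prod>s=1..m. ?T s)"
      by (simp only: mult_ac)
    also have "\<dots> = (pochhammer d n)\<^sup>2 * chain_weight (k\<^sup>2) ?t m n (l, j)"
      using power_card_uncovered[OF c _ m, of k] k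
      by (simp only: chain_weight_def case_prod_conv mult.assoc)
    finally show ?thesis .
  qed
  have "cmod (cancelled_f_coeff \<alpha> \<beta> \<gamma> \<delta> w k m n) =
      k ^ (2 * n - 2 * m) * cmod (\<Sum>(l, j)\<in>index_chains m n. ?F l j)"
    unfolding eq using k by (simp only: norm_mult norm_power norm_of_real) simp
  also have "\<dots> \<le> k ^ (2 * n - 2 * m) * (\<Sum>(l, j)\<in>index_chains m n. cmod (?F l j))"
    using k by (intro mult_left_mono order_trans[OF norm_sum] sum_mono) auto
  also have "\<dots> = (\<Sum>(l, j)\<in>index_chains m n. k ^ (2 * n - 2 * m) * cmod (?F l j))"
    by (simp only: sum_distrib_left case_prod_unfold)
  also have "\<dots> \<le> (\<Sum>p\<in>index_chains m n. (pochhammer d n)\<^sup>2 * chain_weight (k\<^sup>2) ?t m n p)"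
    by (intro sum_mono) (use summand in auto)
  finally show ?thesis by (simp only: chain_sum_def sum_distrib_left)
qed

theorem proposition4:
  fixes \<alpha> \<beta> \<gamma> \<delta> w :: complex and k d t :: real and n :: nat
  assumes "\<gamma> \<notin> \<int>\<^sub>\<le>\<^sub>0" and "0 < k" and "k < 1"
  defines "d \<equiv> Max {1, cmod \<alpha>, cmod \<beta>, cmod \<gamma>}"
    and "t \<equiv> cmod w + (1 - k\<^sup>2) * cmod \<delta>"
  shows "cmod (c_coeff \<alpha> \<beta> \<gamma> \<delta> w k n) \<le>
    (pochhammer d n)\<^sup>2 / (fact n * cmod (pochhammer \<gamma> n)) *
      exp (t / (1 - k\<^sup>2) * (\<Sum>j=1..n. 1 / real j))"
proof -
  let ?f = "\<lambda>m. cancelled_f_coeff \<alpha> \<beta> \<gamma> \<delta> w k m n"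
  let ?E = "exp (t / (1 - k\<^sup>2) * (\<Sum>j=1..n. 1 / real j))"
  have d: "1 \<le> d" "cmod \<alpha> \<le> d" "cmod \<beta> \<le> d" "cmod \<gamma> \<le> d"
    by (simp_all add: d_def)
  have q: "0 \<le> k\<^sup>2" "k\<^sup>2 < 1"
    using assms(2,3) by (simp_all add: power_less_one_iff)
  then have t: "0 \<le> t" by (simp add: t_def)
  have "cmod (\<Sum>m\<le>n. ?f m) \<le> (\<Sum>m\<le>n. (pochhammer d n)\<^sup>2 * chain_sum (k\<^sup>2) t m n)"
    unfolding t_def
    by (rule sum_norm_le) (use norm_cancelled_f_coeff_le[OF assms(1-3) _ d] in auto)
  also have "\<dots> \<le> (pochhammer d n)\<^sup>2 * ?E"
    \<comment> \<open>The cutoff in \<open>sum_chain_sum_le\<close> is taken to be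
      \<open>n\<close>.\<close>
    unfolding sum_distrib_left [symmetric]
    by (intro mult_left_mono sum_chain_sum_le q t) simp
  finally have "cmod (\<Sum>m\<le>n. ?f m) / (fact n * cmod (pochhammer \<gamma> n)) \<le>
      (pochhammer d n)\<^sup>2 * ?E / (fact n * cmod (pochhammer \<gamma> n))"
    by (intro divide_right_mono) auto
  \<comment> \<open>The cancelled form represents \<open>c_coeff\<close> for degenerate and
    nondegenerate \<alpha>, \<beta> alike, so no case distinction is left.\<close>
  then show ?thesis
    by (simp add: c_coeff_eq_cancelled norm_divide norm_mult atLeast0AtMost)
qed

end
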